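(* Let $n \ge 1$, let $x_0 = (r_0^{(0)}, r_1^{(0)})$ be the on-chain state of a two-token constant-product pool in raw token units, and let $(\delta_1,\dots,\delta_n)$ be a sequence of fee-free swap inputs, where $\delta_j$ is the amount of token $0$ paid into the pool at step $j$. Let the on-chain trajectory $x_j = (r_0^{(j)}, r_1^{(j)})$ evolve from $x_0$ by the discretized update $$r_0^{(j)} = r_0^{(j-1)} + \delta_j, \qquad r_1^{(j)} = \left\lfloor \frac{r_0^{(j-1)}\, r_1^{(j-1)}}{r_0^{(j)}} \right\rfloor, \qquad 1 \le j \le n.$$ Let the twin trajectory $\widehat{x}_j = (\widehat{r}_0^{(j)}, \widehat{r}_1^{(j)})$ start from the exact snapshot $\widehat{x}_0 = x_0$ and evolve, driven by the same inputs, by the real-valued constant-product update with fee $\phi = 0$: $$\widehat{r}_0^{(j)} = \widehat{r}_0^{(j-1)} + \delta_j, \qquad \widehat{r}_1^{(j)} = \widehat{r}_1^{(j-1)} - \frac{\delta_j\, \widehat{r}_1^{(j-1)}}{\widehat{r}_0^{(j-1)} + \delta_j}, \qquad 1 \le j \le n.$$ Suppose that $B$ is a real number such that $r_0^{(j)} \le B$ for all $1 \le j \le n$. Then the constant-product observable $h_K(r_0, r_1) := r_0 \cdot r_1$ satisfies $$|\,h_K(\widehat{x}_n) - h_K(x_n)\,| \;\le\; nB.$$ Moreover, in the absence of rounding, i.e. if both trajectories are evaluated on real-valued state (the floor in the on-chain update is omitted), the discrepancy $|h_K(\widehat{x}_n) - h_K(x_n)|$ is zero.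
   Context: A constant-product (Uniswap V2 type) pool has a state consisting of a pair of reserves $(r_0, r_1)$ of token $0$ and token $1$. A swap of token $0$ for token $1$ pays an amount of token $0$ into the pool and takes token $1$ out; it is fee-free when the fee parameter $\phi$ equals $0$. The deployed on-chain protocol uses integer arithmetic in raw (minimal) token units with floor rounding on the output leg: the initial on-chain reserves are positive integers and the input amounts $\delta_j$ are nonnegative integers. The "twin" is an off-chain replica of the pool whose reserves are real numbers and whose initial state is an exact copy of the on-chain state. $\lfloor \cdot \rfloor$ denotes the floor function. *)

theory Defs
  imports Complex_Main
begin

text \<open>
  A pool state is a pair (reserve of token 0, reserve of token 1).  All updates are fee-free swaps
  that pay the amount \<open>d\<close> of token 0 into the pool.
\<close>

definition onchain_swap :: "int \<Rightarrow> int \<times> int \<Rightarrow> int \<times> int" where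
  "onchain_swap d x =
     (fst x + d, \<lfloor>real_of_int (fst x * snd x) / real_of_int (fst x + d)\<rfloor>)"

definition unrounded_onchain_swap :: "real \<Rightarrow> real \<times> real \<Rightarrow> real \<times> real" where
  "unrounded_onchain_swap d x = (fst x + d, fst x * snd x / (fst x + d))"

definition twin_swap :: "real \<Rightarrow> real \<times> real \<Rightarrow> real \<times> real" where
  "twin_swap d x = (fst x + d, snd x - d * snd x / (fst x + d))"

text \<open>
  Inputs are indexed from 1: step \<open>j\<close> is driven by \<open>\<delta> j\<close>, and \<open>\<delta> 0\<close> is never used.
\<close>

primrec trajectory :: "('d \<Rightarrow> 's \<Rightarrow> 's) \<Rightarrow> 's \<Rightarrow> (nat \<Rightarrow> 'd) \<Rightarrow> nat \<Rightarrow> 's" where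
  "trajectory swap x0 \<delta> 0 = x0"
| "trajectory swap x0 \<delta> (Suc j) = swap (\<delta> (Suc j)) (trajectory swap x0 \<delta> j)"

definition real_state :: "int \<times> int \<Rightarrow> real \<times> real" where
  "real_state x = (real_of_int (fst x), real_of_int (snd x))"

definition h_K :: "real \<times> real \<Rightarrow> real" where
  "h_K x = fst x * snd x"

end

theory Submission
  imports Defs
begin

text \<open>
  A real-valued swap preserves the product of the reserves, so the twin keeps the initial product.
  Rounding \<open>K / r\<close> down, where \<open>r\<close> is the new reserve of token 0, lowers the product by
  less than \<open>r \<le> B\<close>; hence \<open>n\<close> on-chain swaps lower it by at most \<open>n * B\<close>.
\<close>

lemma h_K_unrounded_onchain_swap:
  "fst x + d \<noteq> 0 \<Longrightarrow> h_K (unrounded_onchain_swap d x) = h_K x"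
  by (simp add: h_K_def unrounded_onchain_swap_def)

text \<open>Over the common denominator, \<open>snd x - d * snd x / (fst x + d)\<close> has
  numerator \<open>fst x * snd x\<close>. At denominator 0, where HOL division returns 0, the two
  sides would have second components \<open>snd x\<close> and 0.\<close>

lemma twin_swap_eq_unrounded:
  "fst x + d \<noteq> 0 \<Longrightarrow> twin_swap d x = unrounded_onchain_swap d x"
  by (simp add: twin_swap_def unrounded_onchain_swap_def field_simps)

text \<open>Supplies the positive denominators for every later step. The swap and the number type
  are left generic so that one induction serves both the integer and the real trajectories.\<close>

lemma trajectory_fst_pos:
  fixes d :: "nat \<Rightarrow> 'a::linordered_idom"
  assumes "\<And>a x. fst (swap a x) = fst x + a"
    and "fst x0 > 0" and "\<forall>j\<in>{1..n}. d j \<ge> 0"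
  shows "fst (trajectory swap x0 d n) > 0"
  using assms(3) by (induction n) (auto simp: assms(1,2) add_pos_nonneg)

text \<open>Comparing whole states rather than products settles the claim without rounding at once
  and lets the twin inherit the invariant of the unrounded update.\<close>

lemma trajectory_twin_eq_unrounded:
  assumes "fst x0 > 0" and "\<forall>j\<in>{1..n}. d j \<ge> 0"
  shows "trajectory twin_swap x0 d n = trajectory unrounded_onchain_swap x0 d n"
  using assms(2)
proof (induction n)
  case (Suc n)
  have "fst (trajectory unrounded_onchain_swap x0 d n) > 0"
    by (rule trajectory_fst_pos)
       (use assms(1) Suc.prems in \<open>auto simp: unrounded_onchain_swap_def\<close>)
  moreover have "d (Suc n) \<ge> 0"
    using Suc.prems by simp
  ultimately have "fst (trajectory unrounded_onchain_swap x0 d n) + d (Suc n) \<noteq> 0"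
    by linarith
  then show ?case
    using Suc by (simp add: twin_swap_eq_unrounded)
qed simp

lemma h_K_trajectory_unrounded:
  assumes "fst x0 > 0" and "\<forall>j\<in>{1..n}. d j \<ge> 0"
  shows "h_K (trajectory unrounded_onchain_swap x0 d n) = h_K x0"
  using assms(2)
proof (induction n)
  case (Suc n)
  have "fst (trajectory unrounded_onchain_swap x0 d n) > 0"
    by (rule trajectory_fst_pos)
       (use assms(1) Suc.prems in \<open>auto simp: unrounded_onchain_swap_def\<close>)
  moreover have "d (Suc n) \<ge> 0"
    using Suc.prems by simp
  ultimately have "fst (trajectory unrounded_onchain_swap x0 d n) + d (Suc n) \<noteq> 0"
    by linarith
  then show ?case
    using Suc by (simp add: h_K_unrounded_onchain_swap)
qed simp

lemma h_K_onchain_swap_bounds: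
  assumes "fst x + d > 0"
  shows "h_K (real_state (onchain_swap d x)) \<le> h_K (real_state x)"
    and "h_K (real_state x) - real_of_int (fst x + d) \<le> h_K (real_state (onchain_swap d x))"
proof -
  define r where "r = real_of_int (fst x + d)"
  \<comment> \<open>With \<open>q\<close> the quotient before rounding, the old product is
    \<open>r * q\<close> and the new one \<open>r * \<lfloor>q\<rfloor>\<close>; both bounds are
    then q - 1 \<le> \<lfloor>q\<rfloor> \<le> q scaled by \<open>r\<close>.\<close>
  define q where "q = real_of_int (fst x * snd x) / r"
  have "r > 0"
    using assms unfolding r_def by linarith
  have K: "h_K (real_state x) = r * q"
    using \<open>r > 0\<close> by (simp add: h_K_def real_state_def q_def)
  have K': "h_K (real_state (onchain_swap d x)) = r * real_of_int \<lfloor>q\<rfloor>"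
    by (simp add: h_K_def real_state_def onchain_swap_def q_def r_def)
  show "h_K (real_state (onchain_swap d x)) \<le> h_K (real_state x)"
    using \<open>r > 0\<close> unfolding K K' by (intro mult_left_mono) auto
  have "r * (q - 1) \<le> r * real_of_int \<lfloor>q\<rfloor>"
    using \<open>r > 0\<close> by (intro mult_left_mono) linarith+
  then show "h_K (real_state x) - real_of_int (fst x + d) \<le> h_K (real_state (onchain_swap d x))"
    unfolding K K' r_def[symmetric] by (simp add: algebra_simps)
qed

text \<open>Each step is compared with the current on-chain product, so the rounding losses simply
  add up. The upper bound fixes the sign of the error, which later resolves the absolute
  value.\<close>

lemma h_K_trajectory_onchain_bounds:
  assumes "fst x0 > 0" and "\<forall>j\<in>{1..n}. d j \<ge> 0"
    and "\<forall>j\<in>{1..n}. real_of_int (fst (trajectory onchain_swap x0 d j)) \<le> B"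
  shows "h_K (real_state (trajectory onchain_swap x0 d n)) \<le> h_K (real_state x0)
    \<and> h_K (real_state x0) - real n * B \<le> h_K (real_state (trajectory onchain_swap x0 d n))"
  using assms(2,3)
proof (induction n)
  case (Suc n)
  let ?x = "trajectory onchain_swap x0 d n"
  have step: "fst (trajectory onchain_swap x0 d (Suc n)) = fst ?x + d (Suc n)"
    by (simp add: onchain_swap_def)
  have "fst (trajectory onchain_swap x0 d (Suc n)) > 0"
    by (rule trajectory_fst_pos) (use assms(1) Suc.prems in \<open>auto simp: onchain_swap_def\<close>)
  then have "fst ?x + d (Suc n) > 0"
    unfolding step .
  note bounds = h_K_onchain_swap_bounds[OF this]
  \<comment> \<open>The loss in a step is governed by the reserve after the swap, hence index
    \<open>Suc n\<close>.\<close>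
  have "real_of_int (fst (trajectory onchain_swap x0 d (Suc n))) \<le> B"
    by (rule bspec[OF Suc.prems(2)]) simp
  then have "real_of_int (fst ?x + d (Suc n)) \<le> B"
    unfolding step .
  moreover have "h_K (real_state ?x) \<le> h_K (real_state x0)
      \<and> h_K (real_state x0) - real n * B \<le> h_K (real_state ?x)"
    using Suc by simp
  moreover have "real (Suc n) * B = real n * B + B"
    by (simp add: algebra_simps)
  ultimately show ?case
    using bounds unfolding trajectory.simps by linarith
qed simp

theorem proposition1:
  fixes n :: nat and x0 :: "int \<times> int" and \<delta> :: "nat \<Rightarrow> int" and B :: real
  assumes "n \<ge> 1"
    and "fst x0 > 0" and "snd x0 > 0"
    and "\<forall>j\<in>{1..n}. \<delta> j \<ge> 0"
    and "\<forall>j\<in>{1..n}. real_of_int (fst (trajectory onchain_swap x0 \<delta> j)) \<le> B"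
  shows "\<bar>h_K (trajectory twin_swap (real_state x0) (\<lambda>j. real_of_int (\<delta> j)) n)
            - h_K (real_state (trajectory onchain_swap x0 \<delta> n))\<bar> \<le> real n * B
       \<and> (\<forall>(y0 :: real \<times> real) (\<epsilon> :: nat \<Rightarrow> real).
           fst y0 > 0 \<longrightarrow> snd y0 > 0 \<longrightarrow> (\<forall>j\<in>{1..n}. \<epsilon> j \<ge> 0) \<longrightarrow>
           \<bar>h_K (trajectory twin_swap y0 \<epsilon> n)
              - h_K (trajectory unrounded_onchain_swap y0 \<epsilon> n)\<bar> = 0)"
proof (intro conjI allI impI)
  \<comment> \<open>The shared initial product is the reference value for both trajectories.\<close>
  have "h_K (trajectory twin_swap (real_state x0) (\<lambda>j. real_of_int (\<delta> j)) n) = h_K (real_state x0)"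
    using assms(2,4)
    by (simp add: trajectory_twin_eq_unrounded h_K_trajectory_unrounded real_state_def)
  then show "\<bar>h_K (trajectory twin_swap (real_state x0) (\<lambda>j. real_of_int (\<delta> j)) n)
      - h_K (real_state (trajectory onchain_swap x0 \<delta> n))\<bar> \<le> real n * B"
    using h_K_trajectory_onchain_bounds[OF assms(2,4,5)] by linarith
qed (simp add: trajectory_twin_eq_unrounded)

end
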